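(* Let $k\ge 1$, let $i\in\{1,\dots,k\}$, put $j=k-i$, and let $\hat x$ be a nonzero element of $X_\mathcal{A}^i$. For $h\in\{1,\dots,j+1\}$ put $$x_h=\sum_{\ell=1}^{j+1}\sin\!\Big(\frac{\ell h\pi}{j+2}\Big)(\theta_L^* )^{j+1-\ell}(\theta_R^* )^{\ell-1}\hat x\in V_\mathcal{A}^{k},\qquad \lambda_h=2-2\cos\!\Big(\frac{h\pi}{j+2}\Big).$$ Then each $x_h$ is an eigenvector of $\Lambda_V:V_\mathcal{A}^k\to V_\mathcal{A}^k$ with eigenvalue $\lambda_h$ (in particular, if $\hat x\in X_\mathcal{A}^k$, i.e. $j=0$, then $x_1=\hat x$ with eigenvalue $2$). Moreover $f_0^{\otimes k}$ lies in the kernel of $\Lambda_V$ (eigenvalue $0$). Further, for $h\in\{0,1,\dots,j+1\}$ put $$v_h=\sum_{\ell=0}^{j+1}\cos\!\Big(\frac{(2\ell+1)h\pi}{2(j+2)}\Big)(\theta_L^* )^{j+1-\ell}(\theta_R^* )^{\ell}\hat x\in V_\mathcal{A}^{k+1},$$ and $\lambda_h=2-2\cos(\frac{h\pi}{j+2})$ (so $\lambda_0=0$). Then $\Lambda_E v_h=\lambda_h v_h$ for every $h\in\{0,\dots,j+1\}$, where $\Lambda_E:V_\mathcal{A}^{k+1}\to V_\mathcal{A}^{k+1}$; in particular $v_0\neq 0$, $v_0\in\ker\Lambda_E$, and moreover $\partial v_0=0$. Finally, $f_0^{\otimes(k+1)}$ and every element of $X_\mathcal{A}^{k+1}$ lie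 in $\ker(\Lambda_E)\cap\ker(\partial)$.
   Context: $\mathcal{A}$ is a finite alphabet with $q=|\mathcal{A}|$ letters. $V_\mathcal{A}=\mathbb{C}^q$ with standard basis $\{e_a\}_{a\in\mathcal{A}}$ and the standard Hermitian inner product; $V_\mathcal{A}^m$ is the $m$-fold tensor power ($V_\mathcal{A}^0=\mathbb{C}$). The de Bruijn vector is $f_0=q^{-1/2}\sum_{a\in\mathcal A}e_a$; fix an orthonormal basis $f_0,f_1,\dots,f_{q-1}$ of $V_\mathcal{A}$ containing $f_0$ (e.g. normalized discrete Fourier basis). For $m\ge1$ the deletion operators $\theta_L,\theta_R:V_\mathcal{A}^m\to V_\mathcal{A}^{m-1}$ are the linear maps with $\theta_L(v_1\otimes\cdots\otimes v_m)=\langle f_0,v_1\rangle\, v_2\otimes\cdots\otimes v_m$ and $\theta_R(v_1\otimes\cdots\otimes v_m)=\langle f_0,v_m\rangle\, v_1\otimes\cdots\otimes v_{m-1}$ (so in the basis $f$, $\theta_L(f_{a_1}\otimes\cdots\otimes f_{a_m})=\delta_{a_1,0}f_{a_2}\otimes\cdots\otimes f_{a_m}$, similarly for $\theta_R$; in the paper these are written $\hat\theta_L,\hat\theta_R$ when expressed in the basis $f$). Their adjoints are $\theta_L^*(u)=f_0\otimes u$, $\theta_R^*(u)=u\otimes f_0$. The incidence operator is $\partial=\theta_L-\theta_R$ with adjoint $\partial^*=\theta_L^*-\theta_R^*$; the vertex Laplacian on $V_\mathcal{A}^k$ is $\Lambda_V=\partial\partial^*$ and the edge Laplacian on $V_\mathcal{A}^{k+1}$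 is $\Lambda_E=\partial^*\partial$. For $i\ge1$, $X_\mathcal{A}^i\subseteq V_\mathcal{A}^i$ is the span of the tensors $f_{a_1}\otimes\cdots\otimes f_{a_i}$ with $a_1\neq0$ and $a_i\neq0$ (equivalently $\ker\theta_L\cap\ker\theta_R$; for $i=1$ it is the span of $f_1,\dots,f_{q-1}$). *)

theory Defs
  imports "HOL-Analysis.Analysis" "HOL-Library.Function_Algebras"
begin

text \<open>
  The alphabet is a finite type \<open>'a\<close>, so \<open>q = CARD('a)\<close>.  The space \<open>V\<close> is \<open>complex ^ 'a\<close> with the
  Hermitian inner product taken linear in its second argument.
\<close>

definition cinner :: "complex ^ 'a \<Rightarrow> complex ^ 'a \<Rightarrow> complex" where
  "cinner u v = (\<Sum>a\<in>UNIV. cnj (u $ a) * v $ a)"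

definition f0 :: "complex ^ 'a" where
  "f0 = complex_of_real (1 / sqrt (real CARD('a))) *s (\<Sum>a\<in>UNIV. axis a 1)"

definition debruijn_onb :: "(nat \<Rightarrow> complex ^ 'a) \<Rightarrow> bool" where
  "debruijn_onb f \<longleftrightarrow>
     f 0 = f0 \<and>
     (\<forall>a<CARD('a). \<forall>b<CARD('a). cinner (f a) (f b) = (if a = b then 1 else 0)) \<and>
     vec.span (f ` {..<CARD('a)}) = UNIV"

text \<open>
  The \<open>m\<close>-fold tensor power of \<open>V\<close> is the space of coordinate arrays indexed by the words of length
  \<open>m\<close>, encoded as functions on all words that vanish off length \<open>m\<close>.  The value at a word \<open>w\<close> is the
  coefficient of the tensor product of the standard basis vectors given by the letters of \<open>w\<close>.
\<close>

type_synonym 'a tens = "'a list \<Rightarrow> complex"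

definition tscale :: "complex \<Rightarrow> 'a tens \<Rightarrow> 'a tens" (infixr "*\<^sub>T" 75) where
  "c *\<^sub>T u = (\<lambda>w. c * u w)"

global_interpretation tens: vector_space tscale
  by unfold_locales (auto simp: tscale_def algebra_simps fun_eq_iff)

definition tpow :: "nat \<Rightarrow> 'a tens set" where
  "tpow m = {u. \<forall>w. length w \<noteq> m \<longrightarrow> u w = 0}"

definition tensor :: "(complex ^ 'a) list \<Rightarrow> 'a tens" where
  "tensor vs = (\<lambda>w. if length w = length vs then \<Prod>i<length vs. (vs ! i) $ (w ! i) else 0)"

definition tinner :: "nat \<Rightarrow> 'a tens \<Rightarrow> 'a tens \<Rightarrow> complex" where
  "tinner m u v = (\<Sum>w | length w = m. cnj (u w) * v w)"

text \<open>
  Each operator below acts on all degrees at once.  The lemmas after the definitions give their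
  action on pure tensors, which determines them on every tensor power by \<open>tpow_eq_span\<close>.
\<close>

definition theta_L :: "'a tens \<Rightarrow> 'a::finite tens" where
  "theta_L u = (\<lambda>w. \<Sum>a\<in>UNIV. cnj (f0 $ a) * u (a # w))"

definition theta_R :: "'a tens \<Rightarrow> 'a::finite tens" where
  "theta_R u = (\<lambda>w. \<Sum>a\<in>UNIV. cnj (f0 $ a) * u (w @ [a]))"

definition theta_L_adj :: "'a tens \<Rightarrow> 'a::finite tens" where
  "theta_L_adj u = (\<lambda>w. if w = [] then 0 else f0 $ hd w * u (tl w))"

definition theta_R_adj :: "'a tens \<Rightarrow> 'a::finite tens" where
  "theta_R_adj u = (\<lambda>w. if w = [] then 0 else u (butlast w) * f0 $ last w)"

definition incidence :: "'a tens \<Rightarrow> 'a::finite tens" where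
  "incidence u = theta_L u - theta_R u"

definition incidence_adj :: "'a tens \<Rightarrow> 'a::finite tens" where
  "incidence_adj u = theta_L_adj u - theta_R_adj u"

definition Lambda_V :: "'a tens \<Rightarrow> 'a::finite tens" where
  "Lambda_V u = incidence (incidence_adj u)"

definition Lambda_E :: "'a tens \<Rightarrow> 'a::finite tens" where
  "Lambda_E u = incidence_adj (incidence u)"

definition ker_on :: "'a tens set \<Rightarrow> ('a tens \<Rightarrow> 'a tens) \<Rightarrow> 'a tens set" where
  "ker_on V T = {u \<in> V. T u = 0}"

definition eigenvector_on :: "'a tens set \<Rightarrow> ('a tens \<Rightarrow> 'a tens) \<Rightarrow> 'a tens \<Rightarrow> complex \<Rightarrow> bool" where
  "eigenvector_on V T u c \<longleftrightarrow> u \<in> V \<and> u \<noteq> 0 \<and> T u = c *\<^sub>T u"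

definition X_space :: "(nat \<Rightarrow> complex ^ 'a) \<Rightarrow> nat \<Rightarrow> 'a tens set" where
  "X_space f i = tens.span {tensor (map f as) | as.
     length as = i \<and> set as \<subseteq> {..<CARD('a)} \<and> hd as \<noteq> 0 \<and> last as \<noteq> 0}"

definition lam :: "nat \<Rightarrow> nat \<Rightarrow> real" where
  "lam j h = 2 - 2 * cos (real h * pi / real (j + 2))"

definition xvec :: "nat \<Rightarrow> 'a::finite tens \<Rightarrow> nat \<Rightarrow> 'a tens" where
  "xvec j x h = (\<Sum>l = 1..j + 1. complex_of_real (sin (real l * real h * pi / real (j + 2))) *\<^sub>T
     (theta_L_adj ^^ (j + 1 - l)) ((theta_R_adj ^^ (l - 1)) x))"

definition vvec :: "nat \<Rightarrow> 'a::finite tens \<Rightarrow> nat \<Rightarrow> 'a tens" where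
  "vvec j x h = (\<Sum>l = 0..j + 1. complex_of_real (cos (real (2 * l + 1) * real h * pi / (2 * real (j + 2)))) *\<^sub>T
     (theta_L_adj ^^ (j + 1 - l)) ((theta_R_adj ^^ l) x))"

lemma subspace_tpow: "tens.subspace (tpow m)"
  by (auto simp: tens.subspace_def tpow_def tscale_def)

lemma tensor_in_tpow: "length vs = m \<Longrightarrow> tensor vs \<in> tpow m"
  by (simp add: tensor_def tpow_def)

lemma tensor_axis:
  "tensor (map (\<lambda>a. axis a 1) w) = (\<lambda>w'. if w' = w then 1 else 0)"
proof
  fix w'
  show "tensor (map (\<lambda>a. axis a 1) w) w' = (if w' = w then 1 else 0)"
  proof (cases "length w' = length w \<and> w' \<noteq> w")
    case True
    then obtain i where "i < length w" "w' ! i \<noteq> w ! i"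
      by (metis nth_equalityI)
    then show ?thesis
      using True by (auto simp: tensor_def axis_def intro!: prod_zero)
  qed (auto simp: tensor_def axis_def)
qed

lemma sum_tens_apply: "(\<Sum>i\<in>I. u i) w = (\<Sum>i\<in>I. u i w :: complex)"
  by (induction I rule: infinite_finite_induct) auto

lemma finite_words: "finite {w :: 'a::finite list. length w = m}"
  using finite_lists_length_eq[of "UNIV :: 'a set" m] by simp

lemma tpow_eq_span:
  "tpow m = tens.span (tensor ` {vs :: (complex ^ 'a::finite) list. length vs = m})" (is "_ = ?S")
proof
  show "?S \<subseteq> tpow m"
    by (rule tens.span_minimal) (auto simp: tensor_in_tpow subspace_tpow)
  show "tpow m \<subseteq> ?S"
  proof
    fix u :: "'a tens" assume u: "u \<in> tpow m"
    have "u = (\<Sum>w | length w = m. u w *\<^sub>T tensor (map (\<lambda>a. axis a 1) w))" (is "_ = ?s")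
    proof
      fix w' :: "'a list"
      have "?s w' = (\<Sum>w | length w = m. if w' = w then u w else 0)"
        by (simp add: sum_tens_apply tensor_axis tscale_def if_distrib cong: if_cong)
      also have "\<dots> = u w'"
        using u by (auto simp: sum.delta' finite_words tpow_def)
      finally show "u w' = ?s w'" ..
    qed
    also have "\<dots> \<in> ?S"
      by (intro tens.span_sum tens.span_scale tens.span_base) auto
    finally show "u \<in> ?S" .
  qed
qed

lemma theta_L_tensor: "theta_L (tensor (v # vs)) = cinner f0 v *\<^sub>T tensor vs"
  by (auto simp: fun_eq_iff theta_L_def tensor_def cinner_def tscale_def sum_distrib_right
        prod.lessThan_Suc_shift mult.assoc simp del: prod.lessThan_Suc)

lemma theta_R_tensor: "theta_R (tensor (vs @ [v])) = cinner f0 v *\<^sub>T tensor vs"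
  by (auto simp: fun_eq_iff theta_R_def tensor_def cinner_def tscale_def sum_distrib_right
        nth_append mult_ac)

lemma theta_L_adj_tensor: "theta_L_adj (tensor vs) = tensor (f0 # vs)"
proof
  fix w show "theta_L_adj (tensor vs) w = tensor (f0 # vs) w"
    by (cases w) (auto simp: theta_L_adj_def tensor_def prod.lessThan_Suc_shift
        simp del: prod.lessThan_Suc)
qed

lemma theta_R_adj_tensor: "theta_R_adj (tensor vs) = tensor (vs @ [f0])"
proof
  fix w show "theta_R_adj (tensor vs) w = tensor (vs @ [f0]) w"
    by (cases w rule: rev_cases) (auto simp: theta_R_adj_def tensor_def nth_append)
qed

lemma linear_theta:
  "Vector_Spaces.linear tscale tscale theta_L"
  "Vector_Spaces.linear tscale tscale theta_R"
  "Vector_Spaces.linear tscale tscale theta_L_adj"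
  "Vector_Spaces.linear tscale tscale theta_R_adj"
  by (unfold_locales; auto simp: fun_eq_iff theta_L_def theta_R_def theta_L_adj_def theta_R_adj_def
        tscale_def algebra_simps sum.distrib sum_distrib_left)+

lemma theta_tpow:
  "u \<in> tpow (Suc m) \<Longrightarrow> theta_L u \<in> tpow m"
  "u \<in> tpow (Suc m) \<Longrightarrow> theta_R u \<in> tpow m"
  by (auto simp: tpow_def theta_L_def theta_R_def)

lemma theta_adj_tpow:
  assumes "u \<in> tpow m"
  shows "theta_L_adj u \<in> tpow (Suc m)" "theta_R_adj u \<in> tpow (Suc m)"
proof -
  have *: "u (tl w) = 0 \<and> u (butlast w) = 0" if "w \<noteq> []" "length w \<noteq> Suc m" for w
  proof -
    have "length w - 1 \<noteq> m"
      using that by (cases w) auto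
    then show ?thesis
      using assms by (auto simp: tpow_def)
  qed
  show "theta_L_adj u \<in> tpow (Suc m)" "theta_R_adj u \<in> tpow (Suc m)"
    unfolding tpow_def theta_L_adj_def theta_R_adj_def using * by auto
qed

lemma sum_words_Cons:
  "(\<Sum>w | length w = Suc m. F w) = (\<Sum>w | length w = m. \<Sum>a\<in>(UNIV :: 'a::finite set). F (a # w) :: complex)"
proof -
  have "(\<Sum>w | length w = Suc m. F w) = (\<Sum>(w, a)\<in>{w. length w = m} \<times> (UNIV :: 'a set). F (a # w))"
    by (rule sum.reindex_bij_witness[where i = "\<lambda>(w, a). a # w" and j = "\<lambda>w. (tl w, hd w)"])
       (auto simp: length_Suc_conv)
  then show ?thesis by (simp add: sum.cartesian_product)
qed

lemma sum_words_snoc: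
  "(\<Sum>w | length w = Suc m. F w) = (\<Sum>w | length w = m. \<Sum>a\<in>(UNIV :: 'a::finite set). F (w @ [a]) :: complex)"
proof -
  have "(\<Sum>w | length w = Suc m. F w) = (\<Sum>(w, a)\<in>{w. length w = m} \<times> (UNIV :: 'a set). F (w @ [a]))"
    by (rule sum.reindex_bij_witness[where i = "\<lambda>(w, a). w @ [a]" and j = "\<lambda>w. (butlast w, last w)"])
       (auto simp: length_Suc_conv_rev)
  then show ?thesis by (simp add: sum.cartesian_product)
qed

lemma theta_L_adjoint: "tinner (Suc m) (theta_L_adj u) v = tinner m u (theta_L v)"
  by (simp add: tinner_def sum_words_Cons theta_L_adj_def theta_L_def sum_distrib_left mult_ac)

lemma theta_R_adjoint: "tinner (Suc m) (theta_R_adj u) v = tinner m u (theta_R v)"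
  by (simp add: tinner_def sum_words_snoc theta_R_adj_def theta_R_def sum_distrib_left mult_ac)

lemma incidence_adjoint: "tinner (Suc m) (incidence_adj u) v = tinner m u (incidence v)"
  using theta_L_adjoint[of m u v] theta_R_adjoint[of m u v]
  by (simp add: tinner_def incidence_def incidence_adj_def left_diff_distrib right_diff_distrib
      sum_subtractf)

end

theory Submission imports Defs begin

text \<open>
  Let \<open>e a b\<close> be \<open>x\<close> padded with \<open>a\<close> copies of \<open>f0\<close> on the left and \<open>b\<close> on the right.  When both
  deletions kill \<open>x\<close>, left deletion lowers \<open>a\<close> and right deletion lowers \<open>b\<close>, giving \<open>0\<close> when there
  is nothing to lower.  On the combinations of the \<open>e (n - l) l\<close> the incidence operator and its
  adjoint are therefore the difference operators of a path, and the two Laplacians are the second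
  difference operators with Dirichlet and Neumann boundary conditions, which are diagonalised by
  sines and cosines.
\<close>

section \<open>Deletion and insertion at the two ends of a tensor\<close>

global_interpretation theta_L: Vector_Spaces.linear tscale tscale theta_L
  by (rule linear_theta)

global_interpretation theta_R: Vector_Spaces.linear tscale tscale theta_R
  by (rule linear_theta)

global_interpretation theta_L_adj: Vector_Spaces.linear tscale tscale theta_L_adj
  by (rule linear_theta)

global_interpretation theta_R_adj: Vector_Spaces.linear tscale tscale theta_R_adj
  by (rule linear_theta)

lemma incidence_zero [simp]: "incidence 0 = 0"
  by (simp add: incidence_def theta_L.zero theta_R.zero)

lemma incidence_adj_zero [simp]: "incidence_adj 0 = 0"
  by (simp add: incidence_adj_def theta_L_adj.zero theta_R_adj.zero)

lemma f0_nth: "f0 $ (a :: 'a::finite) = complex_of_real (1 / sqrt (real CARD('a)))"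
  by (simp add: f0_def axis_def)

text \<open>The unit norm of \<open>f0\<close> is what makes each deletion a left inverse of the
  insertion at the same end.\<close>

lemma sum_f0_norm: "(\<Sum>a\<in>(UNIV :: 'a::finite set). cnj (f0 $ a) * f0 $ a) = 1"
proof -
  have "cnj (f0 $ a) * f0 $ a = complex_of_real (1 / real CARD('a))" for a :: 'a
    unfolding f0_nth complex_cnj_complex_of_real of_real_mult [symmetric] by simp
  then show ?thesis by simp
qed

lemma theta_L_theta_L_adj [simp]: "theta_L (theta_L_adj u) = u"
  by (simp add: fun_eq_iff theta_L_def theta_L_adj_def sum_f0_norm
      mult.assoc [symmetric] sum_distrib_right [symmetric])

lemma theta_R_theta_R_adj [simp]: "theta_R (theta_R_adj u) = u" for u :: "'a::finite tens"
proof
  fix w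
  have "theta_R (theta_R_adj u) w = (\<Sum>a\<in>(UNIV :: 'a set). cnj (f0 $ a) * f0 $ a * u w)"
    by (simp add: theta_R_def theta_R_adj_def mult_ac)
  then show "theta_R (theta_R_adj u) w = u w"
    by (simp add: sum_f0_norm sum_distrib_right [symmetric])
qed

text \<open>
  The two mixed commutation rules fail in degree zero: there the deletion undoes the insertion.
\<close>

lemma theta_L_theta_R_adj:
  assumes "u [] = 0"
  shows "theta_L (theta_R_adj u) = theta_R_adj (theta_L u)"
proof
  fix w show "theta_L (theta_R_adj u) w = theta_R_adj (theta_L u) w"
    using assms by (cases "w = []") (auto simp: theta_L_def theta_R_adj_def sum_distrib_right mult.assoc)
qed

lemma theta_R_theta_L_adj:
  assumes "u [] = 0"
  shows "theta_R (theta_L_adj u) = theta_L_adj (theta_R u)"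
proof
  fix w show "theta_R (theta_L_adj u) w = theta_L_adj (theta_R u) w"
    using assms by (cases w) (auto simp: theta_R_def theta_L_adj_def sum_distrib_left mult_ac)
qed

text \<open>Holds in every degree: on words of length at most one both sides vanish, and on longer
  words the two ends are distinct letters.\<close>

lemma theta_L_adj_theta_R_adj: "theta_L_adj (theta_R_adj u) = theta_R_adj (theta_L_adj u)"
proof
  fix w show "theta_L_adj (theta_R_adj u) w = theta_R_adj (theta_L_adj u) w"
  proof (cases w)
    case (Cons a v)
    then show ?thesis
      by (cases v rule: rev_cases) (auto simp: theta_L_adj_def theta_R_adj_def butlast_append)
  qed (simp add: theta_L_adj_def theta_R_adj_def)
qed

section \<open>Padded copies of a tensor\<close>

definition pad :: "'a tens \<Rightarrow> nat \<Rightarrow> nat \<Rightarrow> 'a::finite tens" where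
  "pad x a b = (theta_L_adj ^^ a) ((theta_R_adj ^^ b) x)"

lemma theta_L_adj_pad: "theta_L_adj (pad x a b) = pad x (Suc a) b"
  by (simp add: pad_def)

lemma theta_R_adj_pad: "theta_R_adj (pad x a b) = pad x a (Suc b)"
  by (induction a) (simp_all add: pad_def theta_L_adj_theta_R_adj [symmetric])

lemma pad_tpow: "x \<in> tpow i \<Longrightarrow> pad x a b \<in> tpow (i + a + b)"
proof (induction a)
  case 0
  then show ?case
    by (induction b) (auto simp: pad_def theta_adj_tpow)
next
  case (Suc a)
  then show ?case
    by (auto simp: theta_L_adj_pad [symmetric] intro: theta_adj_tpow)
qed

text \<open>Keeps the mixed commutation rules available at every stage of the padding.\<close>

lemma pad_Nil: "x [] = 0 \<Longrightarrow> pad x a b [] = 0"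
  by (cases a; cases b) (simp_all add: pad_def theta_L_adj_def theta_R_adj_def)

text \<open>The left deletion slides through the right insertions until it reaches \<open>x\<close>,
  which it kills.\<close>

lemma theta_L_pad_0:
  assumes "x [] = 0" "theta_L x = 0"
  shows "theta_L (pad x 0 b) = 0"
proof (induction b)
  case 0
  then show ?case using assms by (simp add: pad_def)
next
  case (Suc b)
  then show ?case
    by (simp add: theta_R_adj_pad [symmetric] theta_L_theta_R_adj pad_Nil assms theta_R_adj.zero
        zero_fun_def [symmetric])
qed

lemma theta_R_pad_0:
  assumes "x [] = 0" "theta_R x = 0"
  shows "theta_R (pad x a 0) = 0"
proof (induction a)
  case 0
  then show ?case using assms by (simp add: pad_def)
next
  case (Suc a)
  then show ?case
    by (simp add: theta_L_adj_pad [symmetric] theta_R_theta_L_adj pad_Nil assms theta_L_adj.zero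
        zero_fun_def [symmetric])
qed

section \<open>Combinations along the path of paddings\<close>

definition pad_sum :: "'a::finite tens \<Rightarrow> nat \<Rightarrow> (nat \<Rightarrow> complex) \<Rightarrow> 'a tens" where
  "pad_sum x n c = (\<Sum>l\<le>n. c l *\<^sub>T pad x (n - l) l)"

lemma pad_sum_tpow:
  assumes "x \<in> tpow i"
  shows "pad_sum x n c \<in> tpow (i + n)"
  unfolding pad_sum_def
proof (intro tens.subspace_sum subspace_tpow tens.subspace_scale)
  fix l assume "l \<in> {..n}"
  then show "pad x (n - l) l \<in> tpow (i + n)"
    using pad_tpow [OF assms, of "n - l" l] by simp
qed

lemma pad_sum_diff: "pad_sum x n c - pad_sum x n d = pad_sum x n (\<lambda>l. c l - d l)"
  by (simp add: pad_sum_def sum_subtractf tens.scale_left_diff_distrib)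

lemma pad_sum_scale: "a *\<^sub>T pad_sum x n c = pad_sum x n (\<lambda>l. a * c l)"
  by (simp add: pad_sum_def tens.scale_sum_right)

lemma pad_sum_zero: "pad_sum x n (\<lambda>_. 0) = 0"
  by (simp add: pad_sum_def)

text \<open>The term \<open>l = Suc n\<close> has no \<open>f0\<close> on the left and dies; every
  other term loses one and keeps its index.\<close>

lemma theta_L_pad_sum:
  assumes "x [] = 0" "theta_L x = 0"
  shows "theta_L (pad_sum x (Suc n) c) = pad_sum x n c"
  by (simp add: pad_sum_def theta_L.sum theta_L.scale theta_L.add theta_L_pad_0 assms Suc_diff_le
      theta_L_adj_pad [symmetric])

text \<open>Here the term \<open>l = 0\<close> dies and the surviving indices drop by one, which
  shifts the coefficients.\<close>

lemma theta_R_pad_sum: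
  assumes "x [] = 0" "theta_R x = 0"
  shows "theta_R (pad_sum x (Suc n) c) = pad_sum x n (\<lambda>l. c (Suc l))"
  by (simp add: pad_sum_def sum.atMost_Suc_shift theta_R.sum theta_R.scale theta_R.add theta_R_pad_0
      assms theta_R_adj_pad [symmetric] del: sum.atMost_Suc)

lemma incidence_pad_sum:
  assumes "x [] = 0" "theta_L x = 0" "theta_R x = 0"
  shows "incidence (pad_sum x (Suc n) c) = pad_sum x n (\<lambda>l. c l - c (Suc l))"
  by (simp add: incidence_def theta_L_pad_sum theta_R_pad_sum assms pad_sum_diff)

text \<open>The insertion produces only the indices up to \<open>n\<close>; the zero coefficient
  supplies the missing end term.\<close>

lemma theta_L_adj_pad_sum:
  assumes "c (Suc n) = 0"
  shows "theta_L_adj (pad_sum x n c) = pad_sum x (Suc n) c"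
  by (simp add: pad_sum_def theta_L_adj.sum theta_L_adj.scale theta_L_adj_pad assms Suc_diff_le)

lemma theta_R_adj_pad_sum:
  assumes "c 0 = 0"
  shows "theta_R_adj (pad_sum x n (\<lambda>l. c (Suc l))) = pad_sum x (Suc n) c"
  by (simp add: pad_sum_def sum.atMost_Suc_shift theta_R_adj.sum theta_R_adj.scale theta_R_adj_pad
      assms del: sum.atMost_Suc)

text \<open>The zeros of \<open>s\<close> at \<open>0\<close> and \<open>n + 2\<close> are the
  Dirichlet condition at the two nodes just outside the path. They let both insertions be written as
  sums of the same length.\<close>

lemma incidence_adj_pad_sum:
  assumes "s 0 = 0" "s (Suc (Suc n)) = 0"
  shows "incidence_adj (pad_sum x n (\<lambda>l. s (Suc l))) = pad_sum x (Suc n) (\<lambda>l. s (Suc l) - s l)"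
  by (simp add: incidence_adj_def theta_L_adj_pad_sum theta_R_adj_pad_sum assms pad_sum_diff)

lemma Lambda_V_pad_sum:
  assumes "x [] = 0" "theta_L x = 0" "theta_R x = 0" "s 0 = 0" "s (Suc (Suc n)) = 0"
  shows "Lambda_V (pad_sum x n (\<lambda>l. s (Suc l))) =
    pad_sum x n (\<lambda>l. 2 * s (Suc l) - s l - s (Suc (Suc l)))"
  unfolding Lambda_V_def
  by (subst incidence_adj_pad_sum) (simp_all add: assms incidence_pad_sum algebra_simps)

text \<open>Applying the left deletion \<open>n\<close> times removes every term but the first and
  leaves \<open>c 0\<close> times \<open>x\<close>.\<close>

lemma pad_sum_nonzero:
  assumes "x [] = 0" "theta_L x = 0" "x \<noteq> 0" "c 0 \<noteq> 0"
  shows "pad_sum x n c \<noteq> 0"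
proof (induction n)
  case 0
  then show ?case using assms by (simp add: pad_sum_def pad_def zero_fun_def [symmetric])
next
  case (Suc n)
  then show ?case
    using theta_L_pad_sum [OF assms(1,2), of n c] by (metis theta_L.zero)
qed

section \<open>Sine and cosine eigenvectors\<close>

lemma xvec_eq_pad_sum:
  "xvec j x h = pad_sum x j (\<lambda>l. complex_of_real (sin (real (Suc l) * real h * pi / real (j + 2))))"
  unfolding xvec_def pad_sum_def pad_def
  by (rule sum.reindex_bij_witness [where i = Suc and j = "\<lambda>l. l - 1"]) auto

lemma vvec_eq_pad_sum:
  "vvec j x h = pad_sum x (Suc j)
    (\<lambda>l. complex_of_real (cos (real (2 * l + 1) * real h * pi / (2 * real (j + 2)))))"
  by (simp add: vvec_def pad_sum_def pad_def atLeast0AtMost)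

lemma Lambda_V_xvec:
  assumes "x [] = 0" "theta_L x = 0" "theta_R x = 0"
  shows "Lambda_V (xvec j x h) = complex_of_real (lam j h) *\<^sub>T xvec j x h"
proof -
  define t where "t = real h * pi / real (j + 2)"
  define s where "s l = complex_of_real (sin (real l * t))" for l
  have x: "xvec j x h = pad_sum x j (\<lambda>l. s (Suc l))"
    by (simp add: xvec_eq_pad_sum s_def t_def mult.assoc)
  \<comment> \<open>The angle \<open>t\<close> makes the sine vanish at index \<open>j + 2\<close>,
    one past the last coefficient.\<close>
  have "real (Suc (Suc j)) * t = real h * pi"
    by (simp add: t_def field_simps)
  then have end0: "s (Suc (Suc j)) = 0"
    by (simp only: s_def sin_npi of_real_0)
  have "2 * s (Suc l) - s l - s (Suc (Suc l)) = complex_of_real (lam j h) * s (Suc l)" for l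
  proof -
    \<comment> \<open>Expanding both neighbours about the middle angle cancels the cross terms and
      leaves a factor that depends only on \<open>t\<close>.\<close>
    have "sin (real l * t) = sin (real (Suc l) * t - t)"
      "sin (real (Suc (Suc l)) * t) = sin (real (Suc l) * t + t)"
      by (simp_all add: algebra_simps)
    then have "2 * sin (real (Suc l) * t) - sin (real l * t) - sin (real (Suc (Suc l)) * t) =
        (2 - 2 * cos t) * sin (real (Suc l) * t)"
      unfolding sin_add sin_diff by (simp add: algebra_simps)
    then show ?thesis
      unfolding s_def lam_def t_def [symmetric] by (metis of_real_diff of_real_mult of_real_numeral)
  qed
  then show ?thesis
    using Lambda_V_pad_sum [OF assms, of s j] end0 by (simp add: x pad_sum_scale s_def [of 0])
qed

text \<open>The incidence operator turns the cosines into sines vanishing at both ends, and its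
  adjoint turns these back into a multiple of the cosines. The Neumann condition thus becomes a
  Dirichlet condition on the differences.\<close>

lemma Lambda_E_vvec:
  assumes "x [] = 0" "theta_L x = 0" "theta_R x = 0"
  shows "Lambda_E (vvec j x h) = complex_of_real (lam j h) *\<^sub>T vvec j x h"
proof -
  define t where "t = real h * pi / (2 * real (j + 2))"
  define c where "c l = complex_of_real (cos (real (2 * l + 1) * t))" for l
  \<comment> \<open>Product form of \<open>cos ((2 * l - 1) * t) - cos ((2 * l + 1) * t)\<close>,
    the drop between consecutive cosines; it vanishes at \<open>l = 0\<close>.\<close>
  define s where "s l = complex_of_real (2 * sin t * sin (2 * real l * t))" for l
  have v: "vvec j x h = pad_sum x (Suc j) c"
    by (simp add: vvec_eq_pad_sum c_def [abs_def] t_def mult.assoc)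
  have "2 * real (Suc (Suc j)) * t = real h * pi"
    by (simp add: t_def field_simps)
  then have end0: "s (Suc (Suc j)) = 0"
    by (simp only: s_def sin_npi of_real_0 mult_zero_right)
  have diff: "c l - c (Suc l) = s (Suc l)" for l
  proof -
    have "cos (real (2 * l + 1) * t) = cos (2 * real (Suc l) * t - t)"
      "cos (real (2 * Suc l + 1) * t) = cos (2 * real (Suc l) * t + t)"
      by (simp_all add: algebra_simps)
    then have "cos (real (2 * l + 1) * t) - cos (real (2 * Suc l + 1) * t) =
        2 * sin t * sin (2 * real (Suc l) * t)"
      unfolding cos_add cos_diff by simp
    then show ?thesis
      unfolding s_def c_def by (metis of_real_diff)
  qed
  have diff2: "s (Suc l) - s l = complex_of_real (lam j h) * c l" for l
  proof -
    \<comment> \<open>The midpoint of the two sine angles is exactly the angle in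
      \<open>c l\<close>.\<close>
    define r where "r = real (2 * l + 1) * t"
    have "2 * real l * t = r - t" "2 * real (Suc l) * t = r + t"
      by (simp_all add: r_def algebra_simps)
    moreover have "2 * sin t * sin (r + t) - 2 * sin t * sin (r - t) = 4 * (sin t)\<^sup>2 * cos r"
      by (simp add: sin_add sin_diff algebra_simps power2_eq_square)
    ultimately have "2 * sin t * sin (2 * real (Suc l) * t) - 2 * sin t * sin (2 * real l * t) =
        4 * (sin t)\<^sup>2 * cos (real (2 * l + 1) * t)"
      by (simp only: r_def)
    \<comment> \<open>The angle in \<open>lam\<close> is \<open>2 * t\<close>, and the half-angle
      identity turns \<open>2 - 2 * cos (2 * t)\<close> into \<open>4 * (sin t)^2\<close>.\<close>
    moreover have "real h * pi / real (j + 2) = 2 * t"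
      by (simp add: t_def field_simps)
    then have "4 * (sin t)\<^sup>2 = lam j h"
      using cos_double_sin [of t] by (simp add: lam_def)
    ultimately show ?thesis
      unfolding s_def c_def by (metis of_real_diff of_real_mult)
  qed
  have "incidence (vvec j x h) = pad_sum x j (\<lambda>l. s (Suc l))"
    by (simp add: v incidence_pad_sum assms diff)
  then have "Lambda_E (vvec j x h) = pad_sum x (Suc j) (\<lambda>l. s (Suc l) - s l)"
    unfolding Lambda_E_def using end0 by (simp add: incidence_adj_pad_sum s_def [of 0])
  then show ?thesis
    by (simp add: diff2 v pad_sum_scale)
qed

section \<open>The spaces \<open>X_space\<close> and the powers of \<open>f0\<close>\<close>

lemma X_space_tpow: "x \<in> X_space f i \<Longrightarrow> x \<in> tpow i"
  unfolding X_space_def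
  by (rule subsetD [OF tens.span_minimal]) (auto simp: subspace_tpow intro: tensor_in_tpow)

text \<open>Every generator begins and ends with a basis vector orthogonal to \<open>f0\<close>, and
  linearity covers the span. The bound on \<open>i\<close> makes the index words nonempty, so
  \<open>hd\<close> and \<open>last\<close> are actual letters.\<close>

lemma X_space_theta:
  fixes f :: "nat \<Rightarrow> complex ^ 'a"
  assumes f: "debruijn_onb f" and "i \<ge> 1" and x: "x \<in> X_space f i"
  shows "theta_L x = 0" "theta_R x = 0"
proof -
  have orth: "cinner f0 (f a) = 0" if "a < CARD('a)" "a \<noteq> 0" for a
    using f that unfolding debruijn_onb_def by (metis zero_less_card_finite)
  let ?B = "{tensor (map f as) | as.
    length as = i \<and> set as \<subseteq> {..<CARD('a)} \<and> hd as \<noteq> 0 \<and> last as \<noteq> 0}"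
  have "theta_L u = 0 \<and> theta_R u = 0" if "u \<in> ?B" for u
  proof -
    from that obtain as where as: "u = tensor (map f as)" "length as = i"
      "set as \<subseteq> {..<CARD('a)}" "hd as \<noteq> 0" "last as \<noteq> 0" by blast
    then have ne: "as \<noteq> []" using \<open>i \<ge> 1\<close> by auto
    from ne obtain a bs where "as = a # bs" by (cases as) auto
    then have "theta_L u = 0" using as orth by (simp add: theta_L_tensor)
    moreover from ne obtain b cs where "as = cs @ [b]" by (cases as rule: rev_cases) auto
    then have "theta_R u = 0" using as orth by (simp add: theta_R_tensor)
    ultimately show ?thesis ..
  qed
  then have "tens.span ?B \<subseteq> {u. theta_L u = 0 \<and> theta_R u = 0}"
    by (intro tens.span_minimal)
      (auto simp: tens.subspace_def theta_L.zero theta_R.zero theta_L.add theta_R.add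
        theta_L.scale theta_R.scale)
  then show "theta_L x = 0" "theta_R x = 0"
    using x by (auto simp: X_space_def)
qed

lemma tensor_f0_Suc:
  "theta_L_adj (tensor (replicate k f0)) = tensor (replicate (Suc k) f0)"
  "theta_R_adj (tensor (replicate k f0)) = tensor (replicate (Suc k) f0)"
  by (simp_all add: theta_L_adj_tensor theta_R_adj_tensor replicate_append_same)

text \<open>Inserting \<open>f0\<close> at either end gives the same next power, so the two terms
  cancel.\<close>

lemma incidence_adj_tensor_f0: "incidence_adj (tensor (replicate k f0)) = 0"
  by (simp add: incidence_adj_def tensor_f0_Suc)

lemma incidence_tensor_f0: "incidence (tensor (replicate (Suc k) f0)) = 0"
  unfolding incidence_def
  by (metis tensor_f0_Suc theta_L_theta_L_adj theta_R_theta_R_adj diff_self)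

text \<open>Left deletion descends one power at a time to the empty tensor, whose value at
  \<open>[]\<close> is the empty product.\<close>

lemma tensor_f0_nonzero: "tensor (replicate k f0) \<noteq> (0 :: 'a::finite tens)"
proof (induction k)
  case 0
  have "tensor [] [] \<noteq> (0 :: 'a tens) []" by (simp add: tensor_def)
  then show ?case by (metis replicate_0)
next
  case (Suc k)
  then show ?case
    by (metis tensor_f0_Suc(1) theta_L_theta_L_adj theta_L.zero)
qed

section \<open>Assembly of the spectral statements\<close>

theorem mainTheorem1:
  fixes f :: "nat \<Rightarrow> complex ^ 'a" and k :: nat
  assumes "debruijn_onb f" and "k \<ge> 1"
  shows
    "(\<forall>i\<in>{1..k}. \<forall>x\<in>X_space f i. x \<noteq> 0 \<longrightarrow> (let j = k - i in
        (\<forall>h\<in>{1..j + 1}. eigenvector_on (tpow k) Lambda_V (xvec j x h) (complex_of_real (lam j h))) \<and>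
        (j = 0 \<longrightarrow> xvec j x 1 = x \<and> eigenvector_on (tpow k) Lambda_V x 2) \<and>
        (\<forall>h\<in>{0..j + 1}. vvec j x h \<in> tpow (k + 1) \<and>
           Lambda_E (vvec j x h) = complex_of_real (lam j h) *\<^sub>T vvec j x h) \<and>
        lam j 0 = 0 \<and>
        vvec j x 0 \<noteq> 0 \<and>
        vvec j x 0 \<in> ker_on (tpow (k + 1)) Lambda_E \<and>
        incidence (vvec j x 0) = 0)) \<and>
     tensor (replicate k f0) \<in> ker_on (tpow k) (Lambda_V :: 'a tens \<Rightarrow> 'a tens) \<and>
     eigenvector_on (tpow k) Lambda_V (tensor (replicate k f0) :: 'a tens) 0 \<and>
     tensor (replicate (k + 1) f0) \<in>
       ker_on (tpow (k + 1)) (Lambda_E :: 'a tens \<Rightarrow> 'a tens) \<inter> ker_on (tpow (k + 1)) incidence \<and>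
     X_space f (k + 1) \<subseteq>
       ker_on (tpow (k + 1)) Lambda_E \<inter> ker_on (tpow (k + 1)) incidence"
proof -
  have main: "(\<forall>h\<in>{1..j + 1}. eigenvector_on (tpow k) Lambda_V (xvec j x h) (complex_of_real (lam j h))) \<and>
      (j = 0 \<longrightarrow> xvec j x 1 = x \<and> eigenvector_on (tpow k) Lambda_V x 2) \<and>
      (\<forall>h\<in>{0..j + 1}. vvec j x h \<in> tpow (k + 1) \<and>
         Lambda_E (vvec j x h) = complex_of_real (lam j h) *\<^sub>T vvec j x h) \<and>
      lam j 0 = 0 \<and> vvec j x 0 \<noteq> 0 \<and> vvec j x 0 \<in> ker_on (tpow (k + 1)) Lambda_E \<and>
      incidence (vvec j x 0) = 0"
    if i: "i \<in> {1..k}" and x: "x \<in> X_space f i" "x \<noteq> 0" and j: "j = k - i" for i j x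
  proof -
    have k: "i + j = k" using i j by auto
    have xi: "x \<in> tpow i" using x X_space_tpow by blast
    \<comment> \<open>Degree at least one is what the mixed commutation rules require.\<close>
    have Nil: "x [] = 0" using xi i by (auto simp: tpow_def)
    have LR: "theta_L x = 0" "theta_R x = 0" using X_space_theta [OF assms(1) _ x(1)] i by auto
    have eig: "eigenvector_on (tpow k) Lambda_V (xvec j x h) (complex_of_real (lam j h))"
      if h: "h \<in> {1..j + 1}" for h
    proof -
      \<comment> \<open>Since \<open>h\<close> lies between \<open>1\<close> and
        \<open>j + 1\<close>, the angle lies strictly between \<open>0\<close> and
        \<open>pi\<close>; its sine is the first coefficient of \<open>xvec j x h\<close>.\<close>
      have "0 < real h * pi / real (j + 2)" "real h * pi / real (j + 2) < pi"
        using h by (simp_all add: pos_divide_less_eq mult.commute [of pi])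
      then have "sin (real h * pi / real (j + 2)) \<noteq> 0" using sin_gt_zero by fastforce
      then have "xvec j x h \<noteq> 0"
        unfolding xvec_eq_pad_sum by (intro pad_sum_nonzero) (use Nil LR x in auto)
      then show ?thesis
        using pad_sum_tpow [OF xi, of j] Lambda_V_xvec [OF Nil LR] k
        by (simp add: eigenvector_on_def xvec_eq_pad_sum)
    qed
    have x1: "xvec 0 x 1 = x" by (simp add: xvec_def)
    have lam2: "lam 0 1 = 2" by (simp add: lam_def)
    have lam0: "lam j 0 = 0" by (simp add: lam_def)
    \<comment> \<open>At \<open>h = 0\<close> every cosine is \<open>1\<close>, and constant
      coefficients have zero differences.\<close>
    have v0: "vvec j x 0 = pad_sum x (Suc j) (\<lambda>_. 1)" by (simp add: vvec_eq_pad_sum)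
    have vt: "vvec j x h \<in> tpow (k + 1)" for h
      using pad_sum_tpow [OF xi, of "Suc j"] k by (simp add: vvec_eq_pad_sum)
    have inc0: "incidence (vvec j x 0) = 0"
      by (simp add: v0 incidence_pad_sum Nil LR pad_sum_zero)
    have "vvec j x 0 \<noteq> 0"
      unfolding v0 by (rule pad_sum_nonzero) (use Nil LR x in auto)
    moreover have "j = 0 \<longrightarrow> xvec j x 1 = x \<and> eigenvector_on (tpow k) Lambda_V x 2"
      using eig [of 1] x1 lam2 by auto
    moreover have "vvec j x 0 \<in> ker_on (tpow (k + 1)) Lambda_E"
      using vt inc0 by (simp add: ker_on_def Lambda_E_def)
    ultimately show ?thesis
      using eig vt Lambda_E_vvec [OF Nil LR] lam0 inc0 by blast
  qed
  have T: "tensor (replicate m f0) \<in> (tpow m :: 'a tens set)" for m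
    by (simp add: tensor_in_tpow)
  have V0: "Lambda_V (tensor (replicate k f0) :: 'a tens) = 0"
    by (simp add: Lambda_V_def incidence_adj_tensor_f0)
  have I0: "incidence (tensor (replicate (k + 1) f0) :: 'a tens) = 0"
    using incidence_tensor_f0 [of k] by simp
  have X0: "x \<in> tpow (k + 1)" "incidence x = 0" if "x \<in> X_space f (k + 1)" for x
    using X_space_tpow [OF that] X_space_theta [OF assms(1) _ that] by (auto simp: incidence_def)
  show ?thesis
    unfolding Let_def
    using main T [of k] T [of "k + 1"] V0 I0 X0 tensor_f0_nonzero [of k, where 'a = 'a]
    by (intro conjI ballI impI) (auto simp: ker_on_def eigenvector_on_def Lambda_E_def)
qed

end
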